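(* Let $(X,d)$ be a metric space and let $U\subset X$ be a path-connected subset. Let $M:=\{x_1,x_2,\dots,x_k\}$ be a finite set of points with $M\subset \operatorname{int}(U)$. If for every $x\in X$ and every $\delta>0$ the boundary $\partial B_d(x,\delta)$ of the open ball $B_d(x,\delta)$ is a non-empty and path-connected set, then the set $U\setminus M$ is also path-connected.
   Context: For a metric space $(X,d)$, $x\in X$ and $\delta>0$, $B_d(x,\delta):=\{z\in X: d(z,x)<\delta\}$. For $A\subset X$, $\operatorname{int}(A)$ is the topological interior of $A$, $\overline{A}$ its closure, and $\partial A:=\overline{A}\cap\overline{X\setminus A}$ its topological boundary (so $\partial B_d(x,\delta)$ is the topological boundary of the open ball, not the metric sphere). A metric space $(Y,\rho)$ is path-connected if for every $x,y\in Y$ with $x\neq y$ there exist an interval $I\subset\mathbb{R}$ and a continuous map $\gamma:I\to Y$ with $x,y\in\gamma(I)$ (with this definition the empty space is path-connected). A subset $A\subset X$ is path-connected if it is path-connected as a metric subspace. *)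

theory Defs
  imports "HOL-Analysis.Analysis"
begin

text \<open>
  The library's \<^const>\<open>path_connected\<close> uses paths on the unit interval running from one
  point to the other.  The definition with arbitrary real intervals whose image contains both
  points is equivalent to it.
\<close>

lemma path_connected_iff_interval:
  fixes S :: "'a::topological_space set"
  shows "path_connected S \<longleftrightarrow>
    (\<forall>x\<in>S. \<forall>y\<in>S. x \<noteq> y \<longrightarrow>
      (\<exists>(I::real set) \<gamma>. is_interval I \<and> continuous_on I \<gamma> \<and> \<gamma> ` I \<subseteq> S \<and>
        x \<in> \<gamma> ` I \<and> y \<in> \<gamma> ` I))" (is "?L \<longleftrightarrow> ?R")
proof
  assume L: ?L
  show ?R
  proof (intro ballI impI)
    fix x y assume "x \<in> S" "y \<in> S"
    then obtain g where g: "path g" "path_image g \<subseteq> S" "pathstart g = x" "pathfinish g = y"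
      using L unfolding path_connected_def by blast
    have "x \<in> path_image g" "y \<in> path_image g"
      using g(3,4) pathstart_in_path_image pathfinish_in_path_image by blast+
    moreover have "is_interval {0..1::real}"
      by (simp add: is_interval_convex_1)
    moreover have "continuous_on {0..1} g" "g ` {0..1} \<subseteq> S"
      using g(1,2) by (simp_all add: path_def path_image_def)
    ultimately show "\<exists>(I::real set) \<gamma>. is_interval I \<and> continuous_on I \<gamma> \<and> \<gamma> ` I \<subseteq> S \<and>
        x \<in> \<gamma> ` I \<and> y \<in> \<gamma> ` I"
      unfolding path_image_def by (intro exI[of _ "{0..1}"] exI[of _ g] conjI)
  qed
next
  assume R: ?R
  have "path_component S x y" if xy: "x \<in> S" "y \<in> S" for x y
  proof (cases "x = y")
    case True
    then show ?thesis using xy by (simp add: path_component_refl)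
  next
    case False
    obtain I :: "real set" and \<gamma> where I: "is_interval I" "continuous_on I \<gamma>" "\<gamma> ` I \<subseteq> S"
        "x \<in> \<gamma> ` I" "y \<in> \<gamma> ` I"
      using R[rule_format, OF xy False] by auto
    have "path_connected I"
      using I(1) by (simp add: is_interval_convex_1 convex_imp_path_connected)
    then have "path_connected (\<gamma> ` I)"
      using I(2) by (simp add: path_connected_continuous_image)
    then have "path_component (\<gamma> ` I) x y"
      using I(4,5) unfolding path_connected_component by blast
    then show ?thesis
      using I(3) by (rule path_component_of_subset[rotated])
  qed
  then show ?L by (simp add: path_connected_component)
qed

end

theory Submission
  imports Defs
begin

text \<open>
  Removing one interior point \<open>x\<close> of \<open>U\<close> suffices, by induction on \<open>M\<close>.  Given \<open>a\<close> and \<open>b\<close> in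
  \<open>U - {x}\<close>, take a ball around \<open>x\<close> so small that it misses both of them and its closure lies in
  \<open>U\<close>.  Paths in \<open>U\<close> from \<open>a\<close> to \<open>x\<close> and from \<open>b\<close> to \<open>x\<close>, cut off when they first meet the
  boundary of the ball, avoid \<open>x\<close>, and their ends are joined inside the boundary.
\<close>

text \<open>A path from \<open>a\<close> to \<open>x\<close> is cut at the time \<open>u\<close>
  when it first leaves the interior of \<open>- B\<close>. Only \<open>interior B\<close> is removed
  from \<open>U\<close>, since the endpoint on the frontier may belong to \<open>B\<close>.\<close>

lemma path_component_to_frontier:
  fixes U B :: "'a::metric_space set"
  assumes "path_connected U" "a \<in> U" "a \<notin> B" "x \<in> U" "x \<in> B"
  obtains c where "c \<in> frontier B" "path_component (U - interior B) a c"
proof -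
  obtain g where g: "path g" "path_image g \<subseteq> U" "pathstart g = a" "pathfinish g = x"
    using assms unfolding path_connected_def by blast
  have "pathfinish g \<notin> - B"
    using assms(5) g(4) by simp
  then obtain u where u: "0 \<le> u" "u \<le> 1" "\<forall>t. 0 \<le> t \<and> t < u \<longrightarrow> g t \<in> interior (- B)"
      "g u \<notin> interior (- B)" "u = 0 \<or> g u \<in> closure (- B)"
    by (rule subpath_to_frontier_explicit[OF g(1)]) blast
  have "g 0 = a"
    using g(3) by (simp add: pathstart_def)
  \<comment> \<open>If \<open>u = 0\<close>, then \<open>g u\<close> is \<open>a\<close>, which lies
    outside \<open>B\<close> by assumption.\<close>
  then have "g u \<in> closure (- B)"
    using u(5) assms(3) closure_subset[of "- B"] by auto
  then have front: "g u \<in> frontier B"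
    using u(4) by (simp add: frontier_def closure_complement interior_complement)
  have "g t \<in> U - interior B" if t: "t \<in> {0..u}" for t
  proof
    show "g t \<in> U"
      using g(2) t u(2) by (auto simp: path_image_def)
    show "g t \<notin> interior B"
    proof (cases "t = u")
      case True
      with front show ?thesis by (simp add: frontier_def)
    next
      case False
      with t u(3)[rule_format, of t] show ?thesis
        using interior_subset[of B] interior_subset[of "- B"] by force
    qed
  qed
  then have sub: "g ` {0..u} \<subseteq> U - interior B"
    by blast
  have "continuous_on {0..u} g"
    using g(1) u(2) continuous_on_subset[of "{0..1}" g "{0..u}"] by (simp add: path_def)
  then have "path_connected (g ` {0..u})"
    by (simp add: path_connected_continuous_image convex_imp_path_connected)
  moreover have "a \<in> g ` {0..u}" "g u \<in> g ` {0..u}"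
    using u(1) \<open>g 0 = a\<close> by force+
  ultimately have "path_component (U - interior B) a (g u)"
    using path_component_of_subset[OF sub] unfolding path_connected_component by blast
  with front that show thesis by blast
qed

lemma path_connected_Diff_interior_point:
  fixes U :: "'a::metric_space set"
  assumes U: "path_connected U" and x: "x \<in> interior U"
    and front: "\<And>\<delta>. \<delta> > 0 \<Longrightarrow> path_connected (frontier (ball x \<delta>))"
  shows "path_connected (U - {x})"
  unfolding path_connected_component
proof (intro ballI)
  fix a b assume ab: "a \<in> U - {x}" "b \<in> U - {x}"
  obtain e where e: "e > 0" "cball x e \<subseteq> U"
    using x mem_interior_cball by blast
  \<comment> \<open>The bound \<open>e\<close> keeps the closed ball inside \<open>U\<close>; the
    two distances, positive since \<open>a\<close> and \<open>b\<close> differ from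
    \<open>x\<close>, keep both points out of the open ball, though possibly on its
    frontier.\<close>
  define \<delta> where "\<delta> = min e (min (dist x a) (dist x b))"
  have \<delta>: "\<delta> > 0" "\<delta> \<le> e" "a \<notin> ball x \<delta>" "b \<notin> ball x \<delta>"
    using e(1) ab by (auto simp: \<delta>_def)
  have "x \<in> ball x \<delta>" "x \<in> U"
    using \<delta>(1) x interior_subset by auto
  have reach: "\<exists>c. c \<in> frontier (ball x \<delta>) \<and> path_component (U - ball x \<delta>) p c"
    if "p \<in> U" "p \<notin> ball x \<delta>" for p
    using path_component_to_frontier[OF U that \<open>x \<in> U\<close> \<open>x \<in> ball x \<delta>\<close>]
    unfolding interior_open[OF open_ball] by metis
  obtain c d where
      c: "c \<in> frontier (ball x \<delta>)" "path_component (U - ball x \<delta>) a c" and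
      d: "d \<in> frontier (ball x \<delta>)" "path_component (U - ball x \<delta>) b d"
    using reach[of a] reach[of b] ab \<delta>(3,4) by blast
  \<comment> \<open>In a general metric space the frontier may be smaller than the sphere, but
    inclusion in the sphere already gives that it avoids \<open>x\<close> and stays in
    \<open>U\<close>.\<close>
  have "frontier (ball x \<delta>) \<subseteq> cball x \<delta> - ball x \<delta>"
    using closure_minimal[OF ball_subset_cball closed_cball, of x \<delta>]
    by (auto simp: frontier_def interior_open)
  then have sub: "frontier (ball x \<delta>) \<subseteq> U - {x}"
    using e(2) \<delta>(1,2) by force
  have sub': "U - ball x \<delta> \<subseteq> U - {x}"
    using \<delta>(1) by auto
  have "path_component (U - {x}) c d"
    using front[OF \<delta>(1)] c(1) d(1) path_component_of_subset[OF sub]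
    unfolding path_connected_component by blast
  then show "path_component (U - {x}) a b"
    using path_component_of_subset[OF sub'] c(2) d(2)
    by (meson path_component_sym path_component_trans)
qed

theorem theorem2p2:
  fixes U M :: "'a::metric_space set"
  assumes "path_connected U"
    and "finite M"
    and "M \<subseteq> interior U"
    and "\<And>(x::'a) \<delta>. \<delta> > 0 \<Longrightarrow> frontier (ball x \<delta>) \<noteq> {} \<and> path_connected (frontier (ball x \<delta>))"
  shows "path_connected (U - M)"
  using assms(2,3)
proof (induction M)
  case empty
  then show ?case using assms(1) by simp
next
  case (insert x F)
  \<comment> \<open>The point \<open>x\<close> is removed from \<open>U - F\<close>, so it must be
    interior to that set: finite sets are closed and \<open>x\<close> is not in
    \<open>F\<close>.\<close>
  have "open (interior U - F)"
    using insert.hyps(1) by (simp add: finite_imp_closed open_Diff)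
  moreover have "interior U - F \<subseteq> U - F"
    using interior_subset by blast
  ultimately have "x \<in> interior (U - F)"
    using insert by (meson DiffI insert_subset interior_maximal subsetD)
  then have "path_connected (U - F - {x})"
    using insert assms(4) by (intro path_connected_Diff_interior_point) auto
  then show ?case
    by (metis Diff_insert)
qed

end
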